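(* Let $\kappa\in\{-1,0,1\}$, and let $M^n_\kappa$, the parametrization $x:U\subset\mathbb{R}^n\to M^n_\kappa$ and the function $\rho_\kappa:U\to(0,\infty)$ be as described in the context. Suppose that the local expression of $\xi:M^n_\kappa\to\mathbb{R}$ with respect to the parametrization $x$ (also written $\xi$) satisfies, at each point of the parameter domain $U$ and for all $i,j\in\{1,\dots,n\}$, $$\xi_{,ij}-\frac{(\Delta\xi)_{g_0}}{n}\delta_{ij}+\xi_{,i}\frac{\rho_{\kappa,j}}{\rho_\kappa}+\frac{\rho_{\kappa,i}}{\rho_\kappa}\xi_{,j}-\frac{2}{n}\,g_0\!\left((\nabla\xi)_{g_0},\frac{(\nabla\rho_\kappa)_{g_0}}{\rho_\kappa}\right)\delta_{ij}=0.$$ Then: 1. If $\kappa=0$, then $\xi:\mathbb{R}^n\to\mathbb{R}$ is given by $\xi(x_1,\dots,x_n)=\sum_{i=1}^n\left(\frac a2x_i^2+b_ix_i+c_i\right)$, where $a,b_1,\dots,b_n,c_1,\dots,c_n\in\mathbb{R}$ are constants. 2. If $\kappa=-1$, then $\xi:\mathbb{H}^n\to\mathbb{R}$ is given by $\xi(x_1,\dots,x_n)=\frac1{x_n}\sum_{i=1}^n\left(\frac a2x_i^2+b_ix_i+c_i\right)$, where $a,b_1,\dots,b_n,c_1,\dots,c_n\in\mathbb{R}$ are constants. 3. If $\kappa=1$ and, in addition, it is assumed that there exist $a<0$ and a function $\tilde\xi:(a,\infty)\subset\mathbb{R}\to\mathbb{R}$ such that the local expression of $\xi$ satisfies $\xi(u)=\tilde\xi(r(u))$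 for all $u\in\mathbb{R}^n$, where $r:\mathbb{R}^n\to[0,\infty)$, $r(u_1,\dots,u_n)=\sum_{i=1}^nu_i^2$, then $\xi:\mathbb{S}^n\to\mathbb{R}$ is given by $\xi(p_1,\dots,p_n,p_{n+1})=p_{n+1}$.
   Context: Model spaces. $(M^n_\kappa,g_\kappa)$ is the geodesically complete, simply connected Riemannian space of dimension $n$ and constant sectional curvature $\kappa\in\{-1,0,1\}$, with a parametrization $x:U\subset\mathbb{R}^n\to M^n_\kappa$ in which $g_\kappa(\partial/\partial x_i,\partial/\partial x_j)=\rho_\kappa^{-2}\delta_{ij}$: - $\kappa=0$: $M^n_0=\mathbb{R}^n$, $U=\mathbb{R}^n$, $x$ the identity, $\rho_0=1$. - $\kappa=-1$: $M^n_{-1}=\mathbb{H}^n=\{(x_1,\dots,x_n)\in\mathbb{R}^n: x_n>0\}$, $U=\mathbb{H}^n$, $x$ the identity, $\rho_{-1}=x_n$. - $\kappa=1$: $M^n_1=\mathbb{S}^n=\{(x_1,\dots,x_{n+1})\in\mathbb{R}^{n+1}:\sum_{i=1}^{n+1}x_i^2=1\}$, $U=\mathbb{R}^n\equiv\{x_{n+1}=0\}\subset\mathbb{R}^{n+1}$, and $x$ is the inverse of the stereographic projection with respect to either of the poles: for a choice of $\varepsilon\in\{1,-1\}$, $x:\mathbb{R}^n\to\mathbb{S}^n\setminus\{-\varepsilon e_{n+1}\}$, $x(p)=\frac{2}{1+r}p+\varepsilon\frac{1-r}{1+r}e_{n+1}$, where $r=r(p)=\sum_{i=1}^n p_i^2$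 and $e_{n+1}$ is the last vector of the canonical basis of $\mathbb{R}^{n+1}$; $\rho_1=\frac{1+r}{2}$. Notation. $g_0$ is the Euclidean metric on $U$; $(\nabla\cdot)_{g_0}$ and $(\Delta\cdot)_{g_0}$ are the Euclidean gradient and Laplacian; $\delta_{ij}$ is the Kronecker delta; $\xi_{,i}$, $\xi_{,ij}$, $\rho_{\kappa,i}$ denote partial derivatives on $U$ with respect to the coordinates $x_1,\dots,x_n$.
   Formalization: Part 3 as written is false (ξ = 0 satisfies all hypotheses); what is proved is ξ(p) = A p_{n+1} + B with real constants A, B, for ξ continuous on the sphere. Also n ≥ 2 is assumed, since for n = 1 the equation holds for every ξ. *)

theory Defs
  imports "HOL-Analysis.Analysis"
begin

(* The partial derivative along the i-th coordinate line.  It is a local notion, so for a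
   function given on an open set the values taken outside that set are irrelevant. *)

definition has_partial :: "'n::finite \<Rightarrow> (real ^ 'n \<Rightarrow> real) \<Rightarrow> real ^ 'n \<Rightarrow> bool" where
  "has_partial i f u \<longleftrightarrow> (\<lambda>t. f (u + t *\<^sub>R axis i 1)) differentiable (at 0)"

definition partial :: "'n::finite \<Rightarrow> (real ^ 'n \<Rightarrow> real) \<Rightarrow> real ^ 'n \<Rightarrow> real" where
  "partial i f u = deriv (\<lambda>t. f (u + t *\<^sub>R axis i 1)) 0"

definition grad :: "(real ^ 'n::finite \<Rightarrow> real) \<Rightarrow> real ^ 'n \<Rightarrow> real ^ 'n" where
  "grad f u = (\<chi> i. partial i f u)"

definition laplacian :: "(real ^ 'n::finite \<Rightarrow> real) \<Rightarrow> real ^ 'n \<Rightarrow> real" where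
  "laplacian f u = (\<Sum>i\<in>UNIV. partial i (partial i f) u)"

definition kdelta :: "'n \<Rightarrow> 'n \<Rightarrow> real" where
  "kdelta i j = (if i = j then 1 else 0)"

definition sqr :: "real ^ 'n::finite \<Rightarrow> real" where
  "sqr u = (\<Sum>i\<in>UNIV. (u $ i)\<^sup>2)"

(* The index l plays the role of the last coordinate n, which is distinguished only in the
   half-space model.  It is an arbitrary index because the type 'n carries no order. *)

definition chart_dom :: "'n::finite \<Rightarrow> int \<Rightarrow> (real ^ 'n) set" where
  "chart_dom l \<kappa> = (if \<kappa> = -1 then {u. u $ l > 0} else UNIV)"

definition conf_factor :: "'n::finite \<Rightarrow> int \<Rightarrow> real ^ 'n \<Rightarrow> real" where
  "conf_factor l \<kappa> u =
     (if \<kappa> = -1 then u $ l else if \<kappa> = 1 then (1 + sqr u) / 2 else 1)"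

(* The ambient space of dimension n + 1 is the product of real ^ 'n with real, whose norm is
   Euclidean; thus S^n is "sphere 0 1" there, the coordinate of index n + 1 is snd, and
   (0, 1) is the last basis vector.  The sign \<epsilon> selects the pole: the image of
   inv_stereo \<epsilon> is the sphere without (0, - \<epsilon>). *)

definition inv_stereo :: "real \<Rightarrow> real ^ 'n::finite \<Rightarrow> (real ^ 'n) \<times> real" where
  "inv_stereo \<epsilon> p =
     (2 / (1 + sqr p)) *\<^sub>R (p, 0) + (\<epsilon> * ((1 - sqr p) / (1 + sqr p))) *\<^sub>R (0, 1)"

(* Here f is the local expression of a function on the model space.  The only regularity
   required is that the derivatives occurring in the equation exist; neither total
   differentiability nor continuity or symmetry of the second derivatives is assumed. *)

definition twice_partial_on :: "(real ^ 'n::finite) set \<Rightarrow> (real ^ 'n \<Rightarrow> real) \<Rightarrow> bool" where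
  "twice_partial_on U f \<longleftrightarrow>
     (\<forall>u\<in>U. \<forall>i j. has_partial i f u \<and> has_partial j (partial i f) u)"

definition satisfies_eq :: "'n::finite \<Rightarrow> int \<Rightarrow> (real ^ 'n \<Rightarrow> real) \<Rightarrow> bool" where
  "satisfies_eq l \<kappa> f \<longleftrightarrow>
     twice_partial_on (chart_dom l \<kappa>) f \<and>
     (\<forall>u\<in>chart_dom l \<kappa>. \<forall>i j.
        let \<rho> = conf_factor l \<kappa>; n = real CARD('n) in
          partial j (partial i f) u
          - laplacian f u / n * kdelta i j
          + partial i f u * (partial j \<rho> u / \<rho> u)
          + (partial i \<rho> u / \<rho> u) * partial j f u
          - 2 / n * (grad f u \<bullet> (grad \<rho> u /\<^sub>R \<rho> u)) * kdelta i j = 0)"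

end

theory Submission imports Defs begin

text \<open>
  The equation is a disguised Hessian equation.  In all three models the conformal factor
  \<rho> has Hessian \<tau> \<delta>, with \<tau> = 1 on the sphere and \<tau> = 0 otherwise.  Multiplying the equation
  by \<rho> and adding \<tau> \<xi> \<delta> to both sides completes the product rule, so the equation says that
  \<eta> = \<rho> \<xi> has a Hessian of the form \<mu> \<delta> for some scalar function \<mu>
  (\<open>product_with_conf_factor_hessian\<close>).

  On a product of intervals such an \<eta> is a quadratic polynomial with principal part
  a/2 |u|^2 (\<open>scalar_hessian_imp_quadratic\<close>).  Indeed, the off-diagonal equations say that the
  i-th partial derivative of \<eta> depends on the i-th coordinate only, hence so does \<mu>, the i-th
  derivative of that function; since this holds for two different indices i, \<mu> is a constant a.  Then \<eta> - a/2 |u|^2 has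
  constant first derivatives, and it is affine.  The argument only ever integrates along
  coordinate lines, which is why the bare existence of the partial derivatives suffices.

  Dividing by \<rho> settles the Euclidean and the hyperbolic case.  On the sphere, a radial
  function is even, which removes the linear part; what remains is a combination of 1 and
  (1 - r)/(1 + r), that is, of 1 and the height function.  This describes \<xi> on the sphere
  without one pole, and continuity carries it over to that pole.
\<close>

section \<open>Derivatives along coordinate lines\<close>

text \<open>
  Carrying the value of the derivative in the predicate makes the rules of one-variable
  calculus directly applicable, without side conditions of differentiability.
\<close>

definition has_pderiv :: "'n::finite \<Rightarrow> (real ^ 'n \<Rightarrow> real) \<Rightarrow> real \<Rightarrow> real ^ 'n \<Rightarrow> bool" where
  "has_pderiv i f D u \<longleftrightarrow> ((\<lambda>t. f (u + t *\<^sub>R axis i 1)) has_real_derivative D) (at 0)"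

lemma has_pderiv_partial:
  assumes "has_partial i f u"
  shows "has_pderiv i f (partial i f u) u"
  using assms unfolding has_partial_def has_pderiv_def partial_def
  by (simp add: DERIV_deriv_iff_real_differentiable)

lemma has_pderiv_imp_partial: "has_pderiv i f D u \<Longrightarrow> partial i f u = D"
  unfolding has_pderiv_def partial_def by (rule DERIV_imp_deriv)

lemma has_pderiv_const: "has_pderiv i (\<lambda>u. c) 0 u"
  unfolding has_pderiv_def by simp

lemma has_pderiv_add:
  assumes "has_pderiv i f D u" "has_pderiv i g E u"
  shows "has_pderiv i (\<lambda>u. f u + g u) (D + E) u"
  using assms unfolding has_pderiv_def by (rule DERIV_add)

lemma has_pderiv_diff:
  assumes "has_pderiv i f D u" "has_pderiv i g E u"
  shows "has_pderiv i (\<lambda>u. f u - g u) (D - E) u"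
  using assms unfolding has_pderiv_def by (rule DERIV_diff)

lemma has_pderiv_mult:
  assumes "has_pderiv i f D u" "has_pderiv i g E u"
  shows "has_pderiv i (\<lambda>u. f u * g u) (D * g u + E * f u) u"
  using DERIV_mult[OF assms[unfolded has_pderiv_def]] unfolding has_pderiv_def by simp

lemma has_pderiv_sum:
  assumes "\<And>k. k \<in> S \<Longrightarrow> has_pderiv i (f k) (D k) u"
  shows "has_pderiv i (\<lambda>u. \<Sum>k\<in>S. f k u) (\<Sum>k\<in>S. D k) u"
  using assms unfolding has_pderiv_def by (intro DERIV_sum) auto

lemma has_pderiv_coord: "has_pderiv i (\<lambda>u. u $ k) (kdelta k i) u"
  unfolding has_pderiv_def kdelta_def by (auto simp: axis_def intro!: derivative_eq_intros)

lemma sum_kdelta: "(\<Sum>k\<in>(UNIV::'n::finite set). F k * kdelta k i) = F i"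
  by (simp add: kdelta_def if_distrib cong: if_cong)

lemma has_pderiv_quadratic:
  fixes b :: "real ^ 'n::finite"
  shows "has_pderiv i (\<lambda>u. \<Sum>k\<in>UNIV. a / 2 * (u $ k)\<^sup>2 + b $ k * u $ k) (a * u $ i + b $ i) u"
proof -
  have "has_pderiv i (\<lambda>u. a / 2 * (u $ k)\<^sup>2 + b $ k * u $ k)
          ((a * u $ k + b $ k) * kdelta k i) u" for k
    unfolding has_pderiv_def kdelta_def
    by (auto simp: axis_def intro!: derivative_eq_intros)
  then have "has_pderiv i (\<lambda>u. \<Sum>k\<in>UNIV. a / 2 * (u $ k)\<^sup>2 + b $ k * u $ k)
      (\<Sum>k\<in>UNIV. (a * u $ k + b $ k) * kdelta k i) u"
    by (rule has_pderiv_sum)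
  then show ?thesis
    by (simp only: sum_kdelta)
qed

lemma has_pderiv_sqr:
  fixes u :: "real ^ 'n::finite"
  shows "has_pderiv i sqr (2 * u $ i) u"
proof -
  have "(\<lambda>u. \<Sum>k\<in>UNIV. 2 / 2 * (u $ k)\<^sup>2 + (0 :: real ^ 'n) $ k * u $ k) = sqr"
    by (simp add: sqr_def fun_eq_iff)
  then show ?thesis
    using has_pderiv_quadratic[of i 2 0 u] by simp
qed

section \<open>Functions with scalar Hessian on a product of intervals\<close>

text \<open>
  The coordinates in S can be changed one at a time; each change moves along a segment that
  stays inside the product of intervals, where the derivative of f vanishes.
\<close>

lemma zero_pderiv_imp_eq:
  fixes J :: "'n::finite \<Rightarrow> real set"
  assumes cvx: "\<And>i. convex (J i)"
    and zero: "\<And>j w. j \<in> S \<Longrightarrow> \<forall>i. w $ i \<in> J i \<Longrightarrow> has_pderiv j f 0 w"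
    and u: "\<forall>i. u $ i \<in> J i" and v: "\<forall>i. v $ i \<in> J i"
    and agree: "\<And>i. i \<notin> S \<Longrightarrow> u $ i = v $ i"
  shows "f u = f v"
proof -
  have "finite S" by simp
  then show ?thesis using zero u agree
  proof (induction S arbitrary: u rule: finite_induct)
    case empty
    then have "u = v" by (simp add: vec_eq_iff)
    then show ?case by simp
  next
    case (insert j S)
    define line where "line s = u + (s - u $ j) *\<^sub>R axis j 1" for s
    have line_nth: "line s $ i = (if i = j then s else u $ i)" for s i
      by (simp add: line_def axis_def)
    have line_in: "\<forall>i. line s $ i \<in> J i" if "s \<in> J j" for s
      using that insert.prems by (simp add: line_nth)
    have deriv: "((\<lambda>s. f (line s)) has_real_derivative 0) (at s)" if "s \<in> J j" for s
    proof -
      have shift: "line s + t *\<^sub>R axis j 1 = line (t + s)" for t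
        by (simp add: line_def algebra_simps)
      have "has_pderiv j f 0 (line s)"
        using insert.prems(1) line_in[OF that] by blast
      then show ?thesis
        unfolding has_pderiv_def shift
        using DERIV_at_within_shift[of "\<lambda>s. f (line s)" 0 s 0 UNIV]
        by (simp add: add.commute)
    qed
    obtain c where c: "\<And>s. s \<in> J j \<Longrightarrow> f (line s) = c"
      using has_field_derivative_zero_constant[OF cvx[of j], of "\<lambda>s. f (line s)"]
        has_field_derivative_at_within[OF deriv] by blast
    have "f u = f (line (v $ j))"
      using c[of "u $ j"] c[of "v $ j"] insert.prems v by (simp add: line_def)
    also have "\<dots> = f v"
    proof (rule insert.IH)
      show "has_pderiv k f 0 w" if "k \<in> S" "\<forall>i. w $ i \<in> J i" for k w
        using insert.prems(1) that by blast
      show "\<forall>i. line (v $ j) $ i \<in> J i"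
        using line_in v by blast
      show "line (v $ j) $ i = v $ i" if "i \<notin> S" for i
        using insert.prems(3)[of i] that by (auto simp: line_nth)
    qed
    finally show ?case .
  qed
qed

text \<open>
  A derivative along a coordinate line only sees the restriction of the function to a short
  piece of that line, which remains in the product because the factors are open.
\<close>

lemma pderiv_cong_coordinate:
  fixes J :: "'n::finite \<Rightarrow> real set"
  assumes op: "open (J i)"
    and eq: "\<And>u v. \<forall>k. u $ k \<in> J k \<Longrightarrow> \<forall>k. v $ k \<in> J k \<Longrightarrow> u $ i = v $ i \<Longrightarrow> f u = f v"
    and u: "\<forall>k. u $ k \<in> J k" and v: "\<forall>k. v $ k \<in> J k" and uv: "u $ i = v $ i"
    and D: "has_pderiv i f D u" and E: "has_pderiv i f E v"
  shows "D = E"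
proof -
  have "((\<lambda>t. u $ i + t) \<longlongrightarrow> u $ i) (at 0)"
    by (auto intro!: tendsto_eq_intros)
  then have "eventually (\<lambda>t. u $ i + t \<in> J i) (at 0)"
    using topological_tendstoD[OF _ op] u by blast
  then have "eventually (\<lambda>t. u $ i + t \<in> J i) (nhds 0)"
    using u by (simp add: eventually_nhds_conv_at)
  then have "eventually (\<lambda>t. f (u + t *\<^sub>R axis i 1) = f (v + t *\<^sub>R axis i 1)) (nhds 0)"
  proof eventually_elim
    case (elim t)
    show ?case
    proof (rule eq)
      show "\<forall>k. (u + t *\<^sub>R axis i 1) $ k \<in> J k"
        using u elim by (auto simp: axis_def)
      show "\<forall>k. (v + t *\<^sub>R axis i 1) $ k \<in> J k"
        using v elim uv by (auto simp: axis_def)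
    qed (use uv in simp)
  qed
  then have "((\<lambda>t. f (v + t *\<^sub>R axis i 1)) has_real_derivative D) (at 0)"
    using D unfolding has_pderiv_def by (subst (asm) DERIV_cong_ev) auto
  then show ?thesis
    using E unfolding has_pderiv_def by (rule DERIV_unique)
qed

text \<open>
  The family g is the gradient of \<eta>; naming it separately keeps second derivatives free of
  any statement about how \<eta> behaves outside the product of intervals.
\<close>

theorem scalar_hessian_imp_quadratic:
  fixes J :: "'n::finite \<Rightarrow> real set"
  assumes card: "CARD('n) \<ge> 2"
    and op: "\<And>i. open (J i)" and cvx: "\<And>i. convex (J i)" and ne: "\<And>i. J i \<noteq> {}"
    and grad: "\<And>i u. \<forall>k. u $ k \<in> J k \<Longrightarrow> has_pderiv i \<eta> (g i u) u"
    and hess: "\<And>i j u. \<forall>k. u $ k \<in> J k \<Longrightarrow> has_pderiv j (g i) (kdelta i j * \<mu> u) u"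
  obtains a :: real and b c :: "real ^ 'n" where
    "\<And>u. \<forall>k. u $ k \<in> J k \<Longrightarrow>
        \<eta> u = (\<Sum>i\<in>UNIV. a / 2 * (u $ i)\<^sup>2 + b $ i * u $ i + c $ i)"
proof -
  obtain p :: "real ^ 'n" where p: "\<forall>k. p $ k \<in> J k"
  proof
    show "\<forall>k. (\<chi> k. SOME x. x \<in> J k) $ k \<in> J k"
      using ne by (simp add: some_in_eq)
  qed
  have g_eq: "g i u = g i v"
    if "\<forall>k. u $ k \<in> J k" "\<forall>k. v $ k \<in> J k" "u $ i = v $ i" for i u v
  proof (rule zero_pderiv_imp_eq[where S = "- {i}" and J = J])
    show "has_pderiv j (g i) 0 w" if "j \<in> - {i}" "\<forall>k. w $ k \<in> J k" for j w
      using hess[of w j i] that by (simp add: kdelta_def)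
  qed (use that cvx in auto)
  have \<mu>_eq: "\<mu> u = \<mu> v"
    if u: "\<forall>k. u $ k \<in> J k" and v: "\<forall>k. v $ k \<in> J k" and uv: "u $ i = v $ i" for i u v
  proof -
    have "has_pderiv i (g i) (\<mu> u) u" "has_pderiv i (g i) (\<mu> v) v"
      using hess[OF u, of i i] hess[OF v, of i i] by (simp_all add: kdelta_def)
    from pderiv_cong_coordinate[OF op g_eq u v uv this] show ?thesis .
  qed
  have "\<not> (\<forall>i j :: 'n. i = j)"
    using card card_le_Suc0_iff_eq[of "UNIV :: 'n set"] by simp
  then obtain i j :: 'n where ij: "i \<noteq> j" by blast
  define a where "a = \<mu> p"
  have \<mu>: "\<mu> u = a" if u: "\<forall>k. u $ k \<in> J k" for u
  proof -
    \<comment> \<open>The point w shares one coordinate with u and another one with p.\<close>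
    define w where "w = (\<chi> k. if k = i then u $ k else p $ k)"
    have w: "\<forall>k. w $ k \<in> J k" using u p by (simp add: w_def)
    have "\<mu> u = \<mu> w" by (rule \<mu>_eq[OF u w, of i]) (simp add: w_def)
    also have "\<dots> = \<mu> p" by (rule \<mu>_eq[OF w p, of j]) (use ij in \<open>simp add: w_def\<close>)
    finally show ?thesis by (simp add: a_def)
  qed
  define b :: "real ^ 'n" where "b = (\<chi> i. g i p - a * p $ i)"
  have g: "g i u = a * u $ i + b $ i" if u: "\<forall>k. u $ k \<in> J k" for i u
  proof -
    have "g i u - a * u $ i = g i p - a * p $ i"
    proof (rule zero_pderiv_imp_eq[where S = UNIV and J = J and f = "\<lambda>u. g i u - a * u $ i"])
      show "has_pderiv j (\<lambda>u. g i u - a * u $ i) 0 w" if "\<forall>k. w $ k \<in> J k" for j w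
        using has_pderiv_diff[OF hess[OF that, of j i]
            has_pderiv_mult[OF has_pderiv_const[of j a] has_pderiv_coord[of j i w]]]
        by (simp add: \<mu>[OF that])
    qed (use u p cvx in auto)
    then show ?thesis by (simp add: b_def)
  qed
  define q where "q u = (\<Sum>k\<in>UNIV. a / 2 * (u $ k)\<^sup>2 + b $ k * u $ k)" for u :: "real ^ 'n"
  define c :: "real ^ 'n" where "c = (\<chi> i. (\<eta> p - q p) / real CARD('n))"
  have "\<eta> u = (\<Sum>i\<in>UNIV. a / 2 * (u $ i)\<^sup>2 + b $ i * u $ i + c $ i)"
    if u: "\<forall>k. u $ k \<in> J k" for u
  proof -
    have "\<eta> u - q u = \<eta> p - q p"
    proof (rule zero_pderiv_imp_eq[where S = UNIV and J = J and f = "\<lambda>u. \<eta> u - q u"])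
      show "has_pderiv j (\<lambda>u. \<eta> u - q u) 0 w" if "\<forall>k. w $ k \<in> J k" for j w
        using has_pderiv_diff[OF grad[OF that, of j] has_pderiv_quadratic[of j a b w]]
        by (simp add: g[OF that] q_def)
    qed (use u p cvx in auto)
    moreover have "(\<Sum>i\<in>(UNIV::'n set). c $ i) = \<eta> p - q p"
      by (simp add: c_def)
    ultimately show ?thesis
      by (simp add: q_def sum.distrib)
  qed
  then show thesis by (rule that)
qed

section \<open>The conformal factor\<close>

lemma conf_factor_pos: "u \<in> chart_dom l \<kappa> \<Longrightarrow> conf_factor l \<kappa> u > 0"
  by (auto simp: chart_dom_def conf_factor_def sqr_def add_pos_nonneg sum_nonneg split: if_splits)

definition conf_grad :: "'n::finite \<Rightarrow> int \<Rightarrow> 'n \<Rightarrow> real ^ 'n \<Rightarrow> real" where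
  "conf_grad l \<kappa> i u =
     (if \<kappa> = -1 then kdelta l i else if \<kappa> = 1 then u $ i else 0)"

lemma has_pderiv_conf_factor: "has_pderiv i (conf_factor l \<kappa>) (conf_grad l \<kappa> i u) u"
proof -
  have "has_pderiv i (\<lambda>u. (1 + sqr u) * (1 / 2)) (u $ i) u"
    using has_pderiv_mult[OF has_pderiv_add[OF has_pderiv_const[of i 1] has_pderiv_sqr[of i u]]
        has_pderiv_const[of i "1 / 2"]] by simp
  then show ?thesis
    using has_pderiv_coord[of i l u] has_pderiv_const[of i 1 u]
    by (simp add: conf_factor_def[abs_def] conf_grad_def)
qed

lemma has_pderiv_conf_grad:
  "has_pderiv j (conf_grad l \<kappa> i) ((if \<kappa> = 1 then 1 else 0) * kdelta i j) u"
  using has_pderiv_const[of j _ u] has_pderiv_coord[of j i u]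
  by (cases "\<kappa> = -1"; cases "\<kappa> = 1") (simp_all add: conf_grad_def[abs_def])

text \<open>
  By the product rule the Hessian of \<rho> f has entries
  \<rho> f_ij + \<rho>_j f_i + \<rho>_i f_j + f \<rho>_ij.  The equation multiplied by \<rho> turns the first three
  summands into a multiple of the Kronecker delta, and the last one is such a multiple because
  the Hessian of \<rho> is.
\<close>

lemma product_with_conf_factor_hessian:
  fixes l :: "'n::finite"
  assumes eq: "satisfies_eq l \<kappa> f"
  obtains g \<mu> where
    "\<And>i u. u \<in> chart_dom l \<kappa> \<Longrightarrow> has_pderiv i (\<lambda>u. conf_factor l \<kappa> u * f u) (g i u) u"
    "\<And>i j u. u \<in> chart_dom l \<kappa> \<Longrightarrow> has_pderiv j (g i) (kdelta i j * \<mu> u) u"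
proof -
  define \<rho> where "\<rho> = conf_factor l \<kappa>"
  define d where "d = conf_grad l \<kappa>"
  define \<tau> :: real where "\<tau> = (if \<kappa> = 1 then 1 else 0)"
  define n where "n = real CARD('n)"
  define g where "g i u = d i u * f u + partial i f u * \<rho> u" for i u
  define \<mu> where
    "\<mu> u = \<rho> u * (laplacian f u / n + 2 / n * (grad f u \<bullet> (grad \<rho> u /\<^sub>R \<rho> u))) + \<tau> * f u" for u
  have f: "has_pderiv i f (partial i f u) u"
    and ff: "has_pderiv j (partial i f) (partial j (partial i f) u) u"
    if "u \<in> chart_dom l \<kappa>" for i j u
    using eq that by (auto simp: satisfies_eq_def twice_partial_on_def intro: has_pderiv_partial)
  have \<rho>: "has_pderiv i \<rho> (d i u) u" for i u
    unfolding \<rho>_def d_def by (rule has_pderiv_conf_factor)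
  have d: "has_pderiv j (d i) (\<tau> * kdelta i j) u" for i j u
    unfolding d_def \<tau>_def by (rule has_pderiv_conf_grad)
  show thesis
  proof (rule that)
    fix i u assume u: "u \<in> chart_dom l \<kappa>"
    show "has_pderiv i (\<lambda>u. conf_factor l \<kappa> u * f u) (g i u) u"
      using has_pderiv_mult[OF \<rho>[of i u] f[OF u, of i]] by (simp add: g_def \<rho>_def)
  next
    fix i j u assume u: "u \<in> chart_dom l \<kappa>"
    have pos: "\<rho> u > 0" using conf_factor_pos[OF u] by (simp add: \<rho>_def)
    have d_partial: "partial i \<rho> u = d i u" for i
      using \<rho> by (rule has_pderiv_imp_partial)
    have "partial j (partial i f) u - laplacian f u / n * kdelta i j
          + partial i f u * (partial j \<rho> u / \<rho> u) + (partial i \<rho> u / \<rho> u) * partial j f u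
          - 2 / n * (grad f u \<bullet> (grad \<rho> u /\<^sub>R \<rho> u)) * kdelta i j = 0"
      using eq u unfolding satisfies_eq_def Let_def \<rho>_def[symmetric] n_def[symmetric]
      by blast
    then have "\<rho> u * (partial j (partial i f) u + partial i f u * (d j u / \<rho> u)
                 + (d i u / \<rho> u) * partial j f u)
             = \<rho> u * ((laplacian f u / n
                 + 2 / n * (grad f u \<bullet> (grad \<rho> u /\<^sub>R \<rho> u))) * kdelta i j)"
      unfolding d_partial by (simp add: algebra_simps)
    moreover have "\<rho> u * (partial j (partial i f) u + partial i f u * (d j u / \<rho> u)
                 + (d i u / \<rho> u) * partial j f u)
        = \<rho> u * partial j (partial i f) u + partial i f u * d j u + d i u * partial j f u"
      using pos by (simp add: distrib_left)
    ultimately have "\<tau> * kdelta i j * f u + partial j f u * d i u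
          + (partial j (partial i f) u * \<rho> u + d j u * partial i f u) = kdelta i j * \<mu> u"
      by (simp add: \<mu>_def algebra_simps)
    then show "has_pderiv j (g i) (kdelta i j * \<mu> u) u"
      using has_pderiv_add[OF has_pderiv_mult[OF d[of j i u] f[OF u, of j]]
          has_pderiv_mult[OF ff[OF u, of j i] \<rho>[of j u]]]
      by (simp add: g_def[abs_def])
  qed
qed

lemma conf_factor_times_solution_quadratic:
  fixes l :: "'n::finite"
  assumes card: "CARD('n) \<ge> 2" and eq: "satisfies_eq l \<kappa> f"
  obtains a :: real and b c :: "real ^ 'n" where
    "\<And>u. u \<in> chart_dom l \<kappa> \<Longrightarrow>
        conf_factor l \<kappa> u * f u = (\<Sum>i\<in>UNIV. a / 2 * (u $ i)\<^sup>2 + b $ i * u $ i + c $ i)"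
proof -
  define J :: "'n \<Rightarrow> real set" where "J i = (if \<kappa> = -1 \<and> i = l then {0<..} else UNIV)" for i
  have dom: "u \<in> chart_dom l \<kappa> \<longleftrightarrow> (\<forall>k. u $ k \<in> J k)" for u
    by (auto simp: chart_dom_def J_def)
  obtain g \<mu> where g:
    "\<And>i u. \<forall>k. u $ k \<in> J k \<Longrightarrow> has_pderiv i (\<lambda>u. conf_factor l \<kappa> u * f u) (g i u) u"
    "\<And>i j u. \<forall>k. u $ k \<in> J k \<Longrightarrow> has_pderiv j (g i) (kdelta i j * \<mu> u) u"
    using product_with_conf_factor_hessian[OF eq] unfolding dom by blast
  have J: "open (J i)" "convex (J i)" "J i \<noteq> {}" for i
    by (auto simp: J_def)
  show thesis
  proof (rule scalar_hessian_imp_quadratic[where J = J, OF card J g])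
    fix a and b c :: "real ^ 'n"
    assume "\<And>u. \<forall>k. u $ k \<in> J k \<Longrightarrow>
        conf_factor l \<kappa> u * f u = (\<Sum>i\<in>UNIV. a / 2 * (u $ i)\<^sup>2 + b $ i * u $ i + c $ i)"
    then show thesis
      by (intro that[of a b c]) (simp add: dom)
  qed
qed

section \<open>Stereographic projection\<close>

lemma sqr_eq_norm: "sqr u = (norm u)\<^sup>2"
  by (simp add: sqr_def norm_vec_def L2_set_def sum_nonneg)

lemma sqr_scaleR: "sqr (c *\<^sub>R u) = c\<^sup>2 * sqr u"
  by (simp add: sqr_eq_norm power_mult_distrib)

lemma snd_inv_stereo: "snd (inv_stereo \<epsilon> u) = \<epsilon> * ((1 - sqr u) / (1 + sqr u))"
  by (simp add: inv_stereo_def)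

lemma in_range_inv_stereo:
  fixes p :: "(real ^ 'n::finite) \<times> real"
  assumes \<epsilon>: "\<epsilon> \<in> {1, -1}" and p: "p \<in> sphere 0 1" and ne: "p \<noteq> (0, - \<epsilon>)"
  shows "\<exists>u. p = inv_stereo \<epsilon> u"
proof -
  obtain x s where xs: "p = (x, s)" by (cases p)
  have \<epsilon>2: "\<epsilon> * \<epsilon> = 1" using \<epsilon> by auto
  have norm: "sqr x + s\<^sup>2 = 1"
    using p by (simp add: xs norm_Pair sqr_eq_norm)
  have nz: "1 + \<epsilon> * s \<noteq> 0"
  proof
    assume "1 + \<epsilon> * s = 0"
    then have s: "s = - \<epsilon>" using \<epsilon> by auto
    then have "sqr x = 0" using norm \<epsilon> by auto
    then show False using ne s by (simp add: xs sqr_eq_norm)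
  qed
  define u where "u = (1 / (1 + \<epsilon> * s)) *\<^sub>R x"
  have "sqr x = (1 - \<epsilon> * s) * (1 + \<epsilon> * s)"
    using norm \<epsilon> by (auto simp: power2_eq_square algebra_simps)
  then have "sqr u = (1 - \<epsilon> * s) / (1 + \<epsilon> * s)"
    using nz by (simp add: u_def sqr_scaleR power2_eq_square)
  then have "1 + sqr u = 2 / (1 + \<epsilon> * s)" "1 - sqr u = 2 * (\<epsilon> * s) / (1 + \<epsilon> * s)"
    using nz by (simp_all add: field_simps)
  then have "inv_stereo \<epsilon> u = p"
    using nz \<epsilon>2 by (simp add: inv_stereo_def xs u_def mult.assoc[symmetric])
  then show ?thesis by metis
qed

text \<open>The sphere is connected with more than one point, hence none of its points is isolated.\<close>

lemma continuous_constant_on_sphere_minus_point: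
  fixes F :: "(real ^ 'n::finite) \<times> real \<Rightarrow> real"
  assumes cont: "continuous_on (sphere 0 1) F"
    and const: "\<And>p. p \<in> sphere 0 1 \<Longrightarrow> p \<noteq> q \<Longrightarrow> F p = B"
    and p: "p \<in> sphere 0 1"
  shows "F p = B"
proof (cases "p = q")
  case True
  let ?S = "sphere (0 :: (real ^ 'n) \<times> real) 1"
  have "connected ?S"
    by (rule connected_sphere) (simp add: Suc_le_eq)
  moreover have "- p \<in> ?S" "- p \<noteq> p"
  proof -
    show "- p \<in> ?S" using p by simp
    have "p - (- p) = 2 *\<^sub>R p" by (simp add: scaleR_2)
    moreover have "p \<noteq> 0" using p by auto
    ultimately show "- p \<noteq> p" by force
  qed
  then have "?S \<noteq> {x}" for x
    using p by (metis singletonD)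
  ultimately have "p islimpt ?S"
    by (intro connected_imp_perfect p)
  then have "p \<in> closure (?S - {p})"
    by (simp add: islimpt_in_closure)
  moreover have "continuous_on (closure (?S - {p})) F"
    by (rule continuous_on_subset[OF cont closure_minimal]) auto
  ultimately show ?thesis
    using continuous_constant_on_closure[of "?S - {p}" F B p] const True by blast
qed (use const p in blast)

section \<open>The three models\<close>

theorem proposition1:
  fixes l :: "'n::finite"
  assumes "CARD('n) \<ge> 2"
  shows
    "(\<forall>\<xi> :: real ^ 'n \<Rightarrow> real.
        satisfies_eq l 0 \<xi> \<longrightarrow>
        (\<exists>(a::real) (b :: real ^ 'n) (c :: real ^ 'n). \<forall>x.
           \<xi> x = (\<Sum>i\<in>UNIV. a / 2 * (x $ i)\<^sup>2 + b $ i * x $ i + c $ i)))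
     \<and>
     (\<forall>\<xi> :: real ^ 'n \<Rightarrow> real.
        satisfies_eq l (-1) \<xi> \<longrightarrow>
        (\<exists>(a::real) (b :: real ^ 'n) (c :: real ^ 'n). \<forall>x. x $ l > 0 \<longrightarrow>
           \<xi> x = 1 / x $ l * (\<Sum>i\<in>UNIV. a / 2 * (x $ i)\<^sup>2 + b $ i * x $ i + c $ i)))
     \<and>
     (\<forall>\<epsilon>\<in>{1, -1}. \<forall>\<xi> :: (real ^ 'n) \<times> real \<Rightarrow> real.
        continuous_on (sphere 0 1) \<xi> \<longrightarrow>
        satisfies_eq l 1 (\<lambda>u. \<xi> (inv_stereo \<epsilon> u)) \<longrightarrow>
        (\<exists>a<0. \<exists>\<xi>' :: real \<Rightarrow> real.
           \<forall>u. sqr u \<in> {a<..} \<and> \<xi> (inv_stereo \<epsilon> u) = \<xi>' (sqr u)) \<longrightarrow>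
        (\<exists>A B :: real. \<forall>p\<in>sphere 0 1. \<xi> p = A * snd p + B))"
proof (intro conjI allI impI ballI)
  fix \<xi> :: "real ^ 'n \<Rightarrow> real"
  assume "satisfies_eq l 0 \<xi>"
  from conf_factor_times_solution_quadratic[OF assms this]
  show "\<exists>(a::real) (b :: real ^ 'n) (c :: real ^ 'n). \<forall>x.
          \<xi> x = (\<Sum>i\<in>UNIV. a / 2 * (x $ i)\<^sup>2 + b $ i * x $ i + c $ i)"
    by (simp add: conf_factor_def chart_dom_def) metis
next
  fix \<xi> :: "real ^ 'n \<Rightarrow> real"
  assume "satisfies_eq l (-1) \<xi>"
  then obtain a and b c :: "real ^ 'n" where
    "\<And>x. x $ l > 0 \<Longrightarrow> x $ l * \<xi> x = (\<Sum>i\<in>UNIV. a / 2 * (x $ i)\<^sup>2 + b $ i * x $ i + c $ i)"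
    using conf_factor_times_solution_quadratic[OF assms, of l "-1" \<xi>]
    by (auto simp: conf_factor_def chart_dom_def)
  then have "\<forall>x. x $ l > 0 \<longrightarrow>
      \<xi> x = 1 / x $ l * (\<Sum>i\<in>UNIV. a / 2 * (x $ i)\<^sup>2 + b $ i * x $ i + c $ i)"
    by (simp add: field_simps)
  then show "\<exists>(a::real) (b :: real ^ 'n) (c :: real ^ 'n). \<forall>x. x $ l > 0 \<longrightarrow>
      \<xi> x = 1 / x $ l * (\<Sum>i\<in>UNIV. a / 2 * (x $ i)\<^sup>2 + b $ i * x $ i + c $ i)"
    by blast
next
  fix \<epsilon> :: real and \<xi> :: "(real ^ 'n) \<times> real \<Rightarrow> real"
  assume \<epsilon>: "\<epsilon> \<in> {1, -1}" and cont: "continuous_on (sphere 0 1) \<xi>"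
    and eq: "satisfies_eq l 1 (\<lambda>u. \<xi> (inv_stereo \<epsilon> u))"
    and radial: "\<exists>a<0. \<exists>\<xi>' :: real \<Rightarrow> real.
           \<forall>u. sqr u \<in> {a<..} \<and> \<xi> (inv_stereo \<epsilon> u) = \<xi>' (sqr u)"
  obtain \<xi>' where \<xi>': "\<And>u. \<xi> (inv_stereo \<epsilon> u) = \<xi>' (sqr u)"
    using radial by blast
  obtain a and b c :: "real ^ 'n" where quad:
    "\<And>u. (1 + sqr u) / 2 * \<xi>' (sqr u)
        = (\<Sum>i\<in>UNIV. a / 2 * (u $ i)\<^sup>2 + b $ i * u $ i + c $ i)"
    using conf_factor_times_solution_quadratic[OF assms eq]
    by (auto simp: conf_factor_def chart_dom_def \<xi>')
  define C where "C = (\<Sum>i\<in>UNIV. c $ i)"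
  have quad': "(1 + sqr u) / 2 * \<xi>' (sqr u) = a / 2 * sqr u + (\<Sum>i\<in>UNIV. b $ i * u $ i) + C" for u
    unfolding quad by (simp add: sum.distrib sqr_def sum_distrib_left C_def)
  have no_linear: "(\<Sum>i\<in>UNIV. b $ i * u $ i) = 0" for u
  proof -
    have "sqr (- u) = sqr u" by (simp add: sqr_eq_norm)
    then show ?thesis
      using quad'[of u] quad'[of "- u"] by (simp add: sum_negf)
  qed
  \<comment> \<open>The coefficients solve a r + 2 C = A \<epsilon> (1 - r) + B (1 + r) identically in r.\<close>
  define A where "A = \<epsilon> * (C - a / 2)"
  define B where "B = C + a / 2"
  have chart: "\<xi> (inv_stereo \<epsilon> u) - A * snd (inv_stereo \<epsilon> u) = B" for u
  proof -
    have pos: "1 + sqr u > 0" by (simp add: sqr_eq_norm add_pos_nonneg)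
    have "\<xi>' (sqr u) = (a * sqr u + 2 * C) / (1 + sqr u)"
      using quad'[of u] pos by (simp add: no_linear field_simps)
    moreover have "A * (\<epsilon> * ((1 - sqr u) / (1 + sqr u))) = (C - a / 2) * (1 - sqr u) / (1 + sqr u)"
      using \<epsilon> by (auto simp: A_def)
    ultimately have "\<xi> (inv_stereo \<epsilon> u) - A * snd (inv_stereo \<epsilon> u)
        = (a * sqr u + 2 * C - (C - a / 2) * (1 - sqr u)) / (1 + sqr u)"
      by (simp only: \<xi>' snd_inv_stereo diff_divide_distrib)
    also have "a * sqr u + 2 * C - (C - a / 2) * (1 - sqr u) = B * (1 + sqr u)"
      by (simp add: B_def field_simps)
    also have "\<dots> / (1 + sqr u) = B" using pos by simp
    finally show ?thesis .
  qed
  have "\<xi> p - A * snd p = B" if "p \<in> sphere 0 1" for p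
  proof (rule continuous_constant_on_sphere_minus_point[where q = "(0, - \<epsilon>)", OF _ _ that])
    show "continuous_on (sphere 0 1) (\<lambda>p. \<xi> p - A * snd p)"
      by (intro continuous_intros cont)
    show "\<xi> p - A * snd p = B" if "p \<in> sphere 0 1" "p \<noteq> (0, - \<epsilon>)" for p
      using in_range_inv_stereo[OF \<epsilon> that] chart by blast
  qed
  then show "\<exists>A B :: real. \<forall>p\<in>sphere 0 1. \<xi> p = A * snd p + B"
    by (intro exI[of _ A] exI[of _ B]) (simp add: diff_eq_eq add.commute)
qed

end
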